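(* Let $G$ be the graph with vertex set $\mathbb{Z}$ and edge set $\bigcup_{m\ge 0}E_m$ defined in the context. Then $G$ contains, as a subgraph, a dyadic tree rooted at the vertex $t_{1,1}=2$.
   Context: Let $p_i$ denote the $i$th prime ($p_1=2$). For $m\ge 1$ let $l_m=\prod_{i=1}^{2^m}(p_i)^i$ and $t_{m,j}=(p_m)^j$ for $j=1,\dots,2^{m-1}$. Let $E_0=\{(i,i+1): i\in\mathbb{Z}\}$ and, for each integer $m\ge 1$, let $E_m$ be the set of (undirected) edges $(t_{m,j}+kl_{m+1},\,t_{m+1,2j-1}+kl_{m+1})$ and $(t_{m,j}+kl_{m+1},\,t_{m+1,2j}+kl_{m+1})$ over all $k\in\mathbb{Z}$ and $1\le j\le 2^{m-1}$. The graph $G$ has vertex set $\mathbb{Z}$ and edge set $E=\bigcup_{m\ge 0}E_m$. A dyadic tree is the infinite rooted binary tree in which every vertex (including the root) has exactly two children; a subgraph need not be induced. *)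

theory Defs
  imports Main "HOL-Library.Infinite_Set" "HOL-Computational_Algebra.Primes"
begin

record 'a ugraph =
  verts :: "'a set"
  edges :: "'a set set"

definition is_graph :: "'a ugraph \<Rightarrow> bool" where
  "is_graph G \<longleftrightarrow> (\<forall>e\<in>edges G. e \<subseteq> verts G \<and> card e = 2)"

(* Not necessarily induced. *)
definition is_subgraph :: "'a ugraph \<Rightarrow> 'a ugraph \<Rightarrow> bool" where
  "is_subgraph H G \<longleftrightarrow>
     is_graph H \<and> is_graph G \<and> verts H \<subseteq> verts G \<and> edges H \<subseteq> edges G"

definition graph_isomorphism :: "('a \<Rightarrow> 'b) \<Rightarrow> 'a ugraph \<Rightarrow> 'b ugraph \<Rightarrow> bool" where
  "graph_isomorphism f G H \<longleftrightarrow>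
     bij_betw f (verts G) (verts H) \<and> edges H = (\<lambda>e. f ` e) ` edges G"

(* A vertex is the list of left/right choices leading to it from the root [];
   the two children of xs are xs @ [False] and xs @ [True]. *)
definition dyadic_tree :: "bool list ugraph" where
  "dyadic_tree = \<lparr>verts = UNIV, edges = {{xs, xs @ [b]} | xs b. True}\<rparr>"

definition is_dyadic_tree_rooted_at :: "'a ugraph \<Rightarrow> 'a \<Rightarrow> bool" where
  "is_dyadic_tree_rooted_at T r \<longleftrightarrow> (\<exists>f. graph_isomorphism f dyadic_tree T \<and> f [] = r)"

(* The i-th prime counted from 1, so nth_prime 1 = 2; only used for i >= 1. *)
definition nth_prime :: "nat \<Rightarrow> nat" where
  "nth_prime i = enumerate {q. prime q} (i - 1)"

definition l :: "nat \<Rightarrow> int" where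
  "l m = (\<Prod>i = 1..2 ^ m. int (nth_prime i) ^ i)"

definition t :: "nat \<Rightarrow> nat \<Rightarrow> int" where
  "t m j = int (nth_prime m) ^ j"

definition E :: "nat \<Rightarrow> int set set" where
  "E m =
     (if m = 0 then {{i, i + 1} | i. True}
      else {{t m j + k * l (m + 1), t (m + 1) (2 * j - 1) + k * l (m + 1)} | j k.
              1 \<le> j \<and> j \<le> 2 ^ (m - 1)}
         \<union> {{t m j + k * l (m + 1), t (m + 1) (2 * j) + k * l (m + 1)} | j k.
              1 \<le> j \<and> j \<le> 2 ^ (m - 1)})"

definition G :: "int ugraph" where
  "G = \<lparr>verts = UNIV, edges = (\<Union>m. E m)\<rparr>"

end

theory Submission
  imports Defs
begin

text \<open>Taking only the edges with \<open>k = 0\<close> already gives the tree: the two such edges leaving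
  \<open>t m j\<close> towards level \<open>m + 1\<close> lead to \<open>t (m + 1) (2 * j - 1)\<close> and \<open>t (m + 1) (2 * j)\<close>, and by
  uniqueness of prime powers all the vertices reached in this way from \<open>t 1 1\<close> are distinct.\<close>

lemma prime_nth_prime: "prime (nth_prime i)"
  using enumerate_in_set[OF primes_infinite] by (simp add: nth_prime_def)

text \<open>Positivity matters: \<open>i - 1\<close> truncates, so \<open>nth_prime 0\<close> equals
  \<open>nth_prime 1\<close>.\<close>

lemma nth_prime_eq_iff:
  assumes "i \<ge> 1" "j \<ge> 1"
  shows "nth_prime i = nth_prime j \<longleftrightarrow> i = j"
proof -
  have "inj (enumerate {q::nat. prime q})"
    using primes_infinite by (rule inj_enumerate)
  then show ?thesis
    using assms by (auto simp: nth_prime_def inj_eq)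
qed

lemma nth_prime_1: "nth_prime 1 = 2"
proof -
  have "(LEAST q::nat. prime q) = 2"
    by (rule Least_equality) (auto intro: prime_ge_2_nat)
  then show ?thesis
    by (simp add: nth_prime_def enumerate_0)
qed

lemma t_eq_iff:
  assumes "m \<ge> 1" "n \<ge> 1" "i \<ge> 1" "j \<ge> 1"
  shows "t m i = t n j \<longleftrightarrow> m = n \<and> i = j"
proof
  assume "t m i = t n j"
  then have "nth_prime m ^ i = nth_prime n ^ j"
    by (simp add: t_def flip: of_nat_power)
  then have "nth_prime m = nth_prime n \<and> i = j"
    using assms prime_power_inj''[of "nth_prime m" "nth_prime n" i j] by (auto simp: prime_nth_prime)
  then show "m = n \<and> i = j"
    using assms by (simp add: nth_prime_eq_iff)
qed simp

text \<open>There are no loops: for \<open>m \<ge> 1\<close> both ends of an edge in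
  \<open>E m\<close> carry the same shift \<open>k * l (m + 1)\<close>, and the unshifted ends are
  positive powers of different primes.\<close>

lemma is_graph_G: "is_graph G"
  unfolding is_graph_def
proof (intro ballI conjI)
  fix e assume "e \<in> edges G"
  then obtain m where m: "e \<in> E m"
    by (auto simp: G_def)
  show "e \<subseteq> verts G"
    by (simp add: G_def)
  show "card e = 2"
    using m by (auto simp: E_def t_eq_iff split: if_splits)
qed

text \<open>One plus the binary value of the word, its last letter being the lowest bit.\<close>

definition branch_index :: "bool list \<Rightarrow> nat" where
  "branch_index = foldl (\<lambda>j b. if b then 2 * j else 2 * j - 1) 1"

lemma branch_index_simps [simp]:
  "branch_index [] = 1"
  "branch_index (xs @ [b]) = (if b then 2 * branch_index xs else 2 * branch_index xs - 1)"
  by (simp_all add: branch_index_def)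

lemma branch_index_ge_1: "branch_index xs \<ge> 1"
  by (induction xs rule: rev_induct) auto

lemma branch_index_le: "branch_index xs \<le> 2 ^ length xs"
  by (induction xs rule: rev_induct) auto

text \<open>The parity of the index reveals the last choice, and half of it, rounded up, is the
  index of the rest. Equal lengths matter: every word of \<open>False\<close>s has index 1.\<close>

lemma branch_index_inj:
  "length xs = length ys \<Longrightarrow> branch_index xs = branch_index ys \<Longrightarrow> xs = ys"
proof (induction xs arbitrary: ys rule: rev_induct)
  case (snoc b xs)
  then obtain c zs where ys: "ys = zs @ [c]"
    by (cases ys rule: rev_cases) auto
  \<comment> \<open>Indices are at least 1, so \<open>2 * j - 1\<close> does not truncate and is
    odd.\<close>
  have "branch_index xs = branch_index zs \<and> b = c"
    using snoc.prems(2) branch_index_ge_1[of xs] branch_index_ge_1[of zs]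
    unfolding ys branch_index_simps by (cases b; cases c; simp; presburger)
  then show ?case
    using snoc ys by auto
qed simp

definition tree_vertex :: "bool list \<Rightarrow> int" where
  "tree_vertex xs = t (length xs + 1) (branch_index xs)"

lemma inj_tree_vertex: "inj tree_vertex"
  by (rule injI) (simp add: tree_vertex_def t_eq_iff branch_index_ge_1[simplified] branch_index_inj)

lemma tree_vertex_edge: "{tree_vertex xs, tree_vertex (xs @ [b])} \<in> edges G"
proof -
  let ?m = "length xs + 1" and ?j = "branch_index xs"
  have j: "1 \<le> ?j" "?j \<le> 2 ^ (?m - 1)"
    using branch_index_ge_1 branch_index_le by auto
  \<comment> \<open>Keeping \<open>k\<close> general leaves the shift visible, so the edge matches
    the form in \<open>E_def\<close>; \<open>k = 0\<close> comes afterwards.\<close>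
  have "{t ?m ?j + k * l (?m + 1), t (?m + 1) (if b then 2 * ?j else 2 * ?j - 1) + k * l (?m + 1)}
    \<in> E ?m" for k
    using j by (cases b) (unfold E_def, auto)
  from this[of 0] have "{tree_vertex xs, tree_vertex (xs @ [b])} \<in> E ?m"
    by (simp add: tree_vertex_def)
  then show ?thesis
    by (auto simp: G_def)
qed

theorem lemma7:
  "t 1 1 = 2 \<and> (\<exists>T. is_subgraph T G \<and> is_dyadic_tree_rooted_at T (t 1 1))"
proof
  show "t 1 1 = 2"
    by (simp add: t_def nth_prime_1[simplified])
  \<comment> \<open>As the image of the dyadic tree, \<open>T\<close> is isomorphic to it as soon as
    \<open>tree_vertex\<close> is injective.\<close>
  define T where "T = \<lparr>verts = range tree_vertex, edges = (\<lambda>e. tree_vertex ` e) ` edges dyadic_tree\<rparr>"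
  have sub: "edges T \<subseteq> edges G"
    using tree_vertex_edge by (auto simp: T_def dyadic_tree_def)
  have "e \<subseteq> verts T" if "e \<in> edges T" for e
    using that by (auto simp: T_def)
  \<comment> \<open>Edges of \<open>T\<close> have two elements because they are edges of
    \<open>G\<close>.\<close>
  then have "is_subgraph T G"
    using sub is_graph_G by (auto simp: is_subgraph_def is_graph_def G_def)
  moreover have "graph_isomorphism tree_vertex dyadic_tree T"
    using inj_tree_vertex
    by (simp add: graph_isomorphism_def T_def dyadic_tree_def bij_betw_def)
  moreover have "tree_vertex [] = t 1 1"
    by (simp add: tree_vertex_def)
  ultimately show "\<exists>T. is_subgraph T G \<and> is_dyadic_tree_rooted_at T (t 1 1)"
    unfolding is_dyadic_tree_rooted_at_def by blast
qed

end
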